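(* Let $G$ be a biconnected graph that has no single cutsets. Then either $G$ is triconnected or $G$ is a simple cycle.
   Context: All graphs are finite, undirected, without loops or multiple edges. A connected component means the vertex set of a maximal connected subgraph. A set $R\subset V(G)$ is a cutset if $G-R$ (delete the vertices of $R$) is disconnected; $\mathfrak R_2(G)$ is the set of 2-vertex cutsets. $R$ splits $X\subset V(G)$ if $X\setminus R$ is not contained in one connected component of $G-R$. $G$ is $k$-connected if $v(G)>k$ and $G$ has no cutset with at most $k-1$ vertices; biconnected means 2-connected, triconnected means 3-connected. Cutsets $S,T\in\mathfrak R_2(G)$ are independent if neither splits the other; $S\in\mathfrak R_2(G)$ is single if it is independent with all other cutsets of $\mathfrak R_2(G)$. *)

theory Defs
  imports "Graph_Theory.Digraph_Component"
begin

text \<open>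
  Finite simple undirected graphs are the members of the locale \<^locale>\<open>graph\<close>: finite symmetric
  digraphs without loops and without parallel arcs, so that an undirected edge is a pair of opposite
  arcs. On these, \<^const>\<open>Digraph_Component.connected\<close> is ordinary connectedness (and entails having
  a vertex).
\<close>

definition delete_verts :: "('a, 'b) pre_digraph \<Rightarrow> 'a set \<Rightarrow> ('a, 'b) pre_digraph" where
  "delete_verts G R = G \<restriction> (verts G - R)"

text \<open>
  A maximal subdigraph that is (weakly) connected is automatically induced, hence again an
  undirected graph.
\<close>
definition connected_components :: "('a, 'b) pre_digraph \<Rightarrow> 'a set set" where
  "connected_components G =
     verts ` {H. pre_digraph.max_subgraph G Digraph_Component.connected H}"

text \<open>The inclusion is strict because the null graph does not count as disconnected.\<close>
definition cutset :: "('a, 'b) pre_digraph \<Rightarrow> 'a set \<Rightarrow> bool" where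
  "cutset G R \<longleftrightarrow> R \<subset> verts G \<and> \<not> Digraph_Component.connected (delete_verts G R)"

definition cutsets2 :: "('a, 'b) pre_digraph \<Rightarrow> 'a set set" where
  "cutsets2 G = {R. cutset G R \<and> card R = 2}"

definition splits :: "('a, 'b) pre_digraph \<Rightarrow> 'a set \<Rightarrow> 'a set \<Rightarrow> bool" where
  "splits G R X \<longleftrightarrow> \<not> (\<exists>C \<in> connected_components (delete_verts G R). X - R \<subseteq> C)"

definition k_connected :: "nat \<Rightarrow> ('a, 'b) pre_digraph \<Rightarrow> bool" where
  "k_connected k G \<longleftrightarrow> k < card (verts G) \<and> \<not> (\<exists>R. cutset G R \<and> card R < k)"

abbreviation biconnected :: "('a, 'b) pre_digraph \<Rightarrow> bool" where
  "biconnected \<equiv> k_connected 2"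

abbreviation triconnected :: "('a, 'b) pre_digraph \<Rightarrow> bool" where
  "triconnected \<equiv> k_connected 3"

definition independent_cutsets :: "('a, 'b) pre_digraph \<Rightarrow> 'a set \<Rightarrow> 'a set \<Rightarrow> bool" where
  "independent_cutsets G S T \<longleftrightarrow> \<not> splits G S T \<and> \<not> splits G T S"

definition single_cutset :: "('a, 'b) pre_digraph \<Rightarrow> 'a set \<Rightarrow> bool" where
  "single_cutset G S \<longleftrightarrow>
     S \<in> cutsets2 G \<and> (\<forall>T \<in> cutsets2 G. T \<noteq> S \<longrightarrow> independent_cutsets G S T)"

text \<open>
  The whole graph is a single cycle: some closed arc walk \<open>p\<close> without repeated vertices visits every
  vertex, and every arc of the graph is an arc of \<open>p\<close> or the reverse of one. The length bound
  excludes the closed walk \<open>a, b, a\<close>, which \<^const>\<open>pre_digraph.cycle\<close> permits in a symmetric digraph.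
\<close>
definition is_simple_cycle :: "('a, 'b) pre_digraph \<Rightarrow> bool" where
  "is_simple_cycle G \<longleftrightarrow>
     (\<exists>p. pre_digraph.cycle G p \<and> 3 \<le> length p \<and> verts G = tail G ` set p \<and>
          arcs_ends G = arc_to_ends G ` set p \<union> (arc_to_ends G ` set p)\<inverse>)"

end

theory Submission
  imports Defs
begin

text \<open>
  Two dependent cutsets \<open>{a, b}\<close> and \<open>{c, d}\<close> of a biconnected graph split each other, and
  \<open>{c, d}\<close> has a vertex in every component left by \<open>{a, b}\<close>. Hence, if no cutset is single, every
  2-vertex cutset leaves exactly two components and its vertices are not adjacent. Let \<open>C\<close> be one
  component, with \<open>c\<close> in \<open>C\<close>. The part of \<open>C\<close> that \<open>{c, d}\<close> leaves on the side of \<open>a\<close> is either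
  empty, and then \<open>a\<close> and \<open>c\<close> are adjacent, or a component left by the cutset \<open>{a, c}\<close>, and likewise for \<open>b\<close>; so by induction on the
  size of \<open>C\<close> the vertices of \<open>C\<close> and \<open>a, b\<close> induce a path from \<open>a\<close> to \<open>b\<close>. The paths through
  the two components form the cycle.
\<close>

section \<open>Separations\<close>

text \<open>For symmetric \<open>E\<close>, \<open>D\<close> is a proper nonempty union of
  components of the graph induced on \<open>X\<close>. Allowing unions makes the notion closed under
  complement, and no component has to be identified.\<close>

definition separation :: "('a \<times> 'a) set \<Rightarrow> 'a set \<Rightarrow> 'a set \<Rightarrow> bool" where
  "separation E X D \<longleftrightarrow> D \<subseteq> X \<and> D \<noteq> {} \<and> D \<noteq> X \<and> (\<forall>u\<in>D. \<forall>v\<in>X - D. (u, v) \<notin> E)"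

lemma separation_complement:
  assumes "sym E" "separation E X D"
  shows "separation E X (X - D)"
  using assms unfolding separation_def sym_def by blast

section \<open>Induced paths as vertex lists\<close>

definition steps :: "'a list \<Rightarrow> ('a \<times> 'a) set" where
  "steps vs = set (zip vs (tl vs))"

lemma steps_simps [simp]:
  "steps [] = {}"
  "steps [u] = {}"
  "steps (u # v # vs) = insert (u, v) (steps (v # vs))"
  by (simp_all add: steps_def)

lemma steps_append: "steps (us @ w # vs) = steps (us @ [w]) \<union> steps (w # vs)"
proof (induction us)
  case (Cons u us)
  then show ?case by (cases us) auto
qed simp

lemma steps_subset: "steps vs \<subseteq> set vs \<times> set vs"
  unfolding steps_def by (cases vs) (auto dest: set_zip_leftD set_zip_rightD)

lemma steps_rev: "steps (rev vs) = (steps vs)\<inverse>"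
proof (induction vs rule: induct_list012)
  case (3 u v vs)
  have "steps (rev (u # v # vs)) = steps (rev (v # vs)) \<union> {(v, u)}"
    using steps_append[of "rev vs" v "[u]"] by simp
  then show ?case using 3 by auto
qed simp_all

definition induced_path :: "('a \<times> 'a) set \<Rightarrow> 'a list \<Rightarrow> bool" where
  "induced_path E vs \<longleftrightarrow> distinct vs \<and> E \<inter> set vs \<times> set vs = steps vs \<union> (steps vs)\<inverse>"

text \<open>With no edge between \<open>us\<close> and \<open>vs\<close>, every edge of the joined
  list lies in one of the two halves sharing \<open>w\<close>, so no chord can arise.\<close>

lemma induced_path_append:
  assumes "sym E" "induced_path E (us @ [w])" "induced_path E (w # vs)"
    and "set us \<inter> set vs = {}" "E \<inter> set us \<times> set vs = {}"
  shows "induced_path E (us @ w # vs)"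
proof -
  have "E \<inter> set (us @ w # vs) \<times> set (us @ w # vs) =
      (E \<inter> set (us @ [w]) \<times> set (us @ [w])) \<union> (E \<inter> set (w # vs) \<times> set (w # vs))"
    using assms(1,5) unfolding sym_def by auto
  then show ?thesis
    using assms(2-4) unfolding induced_path_def steps_append[of us w vs] by auto
qed

lemma induced_path_rev: "induced_path E vs \<Longrightarrow> induced_path E (rev vs)"
  unfolding induced_path_def by (auto simp: steps_rev)

section \<open>Crossing cutsets\<close>

text \<open>Biconnectedness in terms of a vertex set and an adjacency relation, so that the
  combinatorial argument is free of arcs.\<close>

locale biconnected_relation =
  fixes V :: "'a set" and E :: "('a \<times> 'a) set"
  assumes finite_V: "finite V"
    and sym_E: "sym E"
    and irrefl_E: "(v, v) \<notin> E"
    and connected_V: "\<not> separation E V D"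
    and no_cutvertex: "x \<in> V \<Longrightarrow> \<not> separation E (V - {x}) D"
begin

text \<open>An edge leaving \<open>F\<close> ends in \<open>c\<close> or \<open>d\<close>, and one
  leaving \<open>D\<close> ends in \<open>a\<close> or \<open>b\<close>. As \<open>a\<close>,
  \<open>b\<close> are outside \<open>F\<close> and \<open>d\<close> is across from
  \<open>D\<close>, the only exit from \<open>F \<inter> D\<close> is \<open>c\<close>, which would
  be a cutvertex.\<close>

lemma crossing_disjoint:
  assumes "a \<in> V" "c \<in> V"
    and D: "separation E (V - {a, b}) D" "c \<in> D" "d \<in> V - {a, b} - D"
    and F: "separation E (V - {c, d}) F" "a \<notin> F" "b \<notin> F"
  shows "F \<inter> D = {}"
proof (rule ccontr)
  assume "F \<inter> D \<noteq> {}"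
  moreover have "a \<in> V - {c} - F \<inter> D"
    using assms unfolding separation_def by blast
  moreover have "(u, v) \<notin> E" if "u \<in> F \<inter> D" "v \<in> V - {c} - F \<inter> D" for u v
  proof (cases "v = d")
    case True
    then show ?thesis using that D unfolding separation_def by blast
  next
    case False
    show ?thesis
    proof (cases "v \<in> F")
      case True
      then have "v \<in> V - {a, b} - D" using that F by blast
      then show ?thesis using that D unfolding separation_def by blast
    next
      case False
      then show ?thesis using that \<open>v \<noteq> d\<close> F unfolding separation_def by blast
    qed
  qed
  moreover have "F \<inter> D \<subseteq> V - {c}"
    using F unfolding separation_def by blast
  ultimately have "separation E (V - {c}) (F \<inter> D)"
    unfolding separation_def by blast
  then show False using no_cutvertex \<open>c \<in> V\<close> by blast
qed

text \<open>Otherwise \<open>crossing_disjoint\<close>, applied to \<open>D\<close> and, with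
  \<open>c\<close> and \<open>d\<close> exchanged, to its complement, leaves no vertex for
  \<open>F\<close>.\<close>

lemma crossing_not_disjoint:
  assumes "a \<in> V"
    and D: "separation E (V - {a, b}) D" "c \<in> D" "d \<in> V - {a, b} - D"
    and F: "separation E (V - {c, d}) F"
  shows "a \<in> F \<or> b \<in> F"
proof (rule ccontr)
  assume *: "\<not> (a \<in> F \<or> b \<in> F)"
  have c: "c \<in> V - {a, b} - (V - {a, b} - D)" "c \<in> V"
    using D unfolding separation_def by auto
  have "F \<inter> D = {}"
    using crossing_disjoint[OF assms(1) c(2) D F] * by blast
  moreover have "F \<inter> (V - {a, b} - D) = {}"
    using crossing_disjoint[OF assms(1) _ separation_complement[OF sym_E D(1)] D(3) c(1), of F] * F D(3)
    by (simp add: insert_commute)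
  moreover have "F \<subseteq> V - {a, b}" "F \<noteq> {}"
    using F * unfolding separation_def by auto
  ultimately show False by blast
qed

text \<open>Both \<open>F\<close> and its complement contain \<open>a\<close> or \<open>b\<close>,
  hence exactly one each. Splitting is therefore mutual, and since \<open>F\<close> may be a single
  component, \<open>{c, d}\<close> leaves exactly two.\<close>

lemma crossing:
  assumes "a \<in> V" "b \<in> V"
    and D: "separation E (V - {a, b}) D" "c \<in> D" "d \<in> V - {a, b} - D"
    and F: "separation E (V - {c, d}) F"
  shows "a \<in> F \<longleftrightarrow> b \<notin> F"
proof -
  have "a \<in> V - {c, d}" "b \<in> V - {c, d}"
    using assms unfolding separation_def by auto
  then show ?thesis
    using crossing_not_disjoint[OF assms(1) D F]
      crossing_not_disjoint[OF assms(1) D separation_complement[OF sym_E F]] by blast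
qed

text \<open>A neighbour of \<open>a\<close> exists because otherwise \<open>b\<close> would be a cutvertex.\<close>
lemma attached:
  assumes "a \<in> V" "b \<in> V" "a \<noteq> b" "separation E (V - {a, b}) D"
  obtains u where "u \<in> D" "(a, u) \<in> E"
proof (rule ccontr)
  assume *: "\<not> thesis"
  have "a \<in> V - {b}" "a \<notin> D" using assms unfolding separation_def by auto
  moreover have "(u, a) \<notin> E" if "u \<in> D" for u
    using * \<open>\<And>u. u \<in> D \<Longrightarrow> (a, u) \<in> E \<Longrightarrow> thesis\<close> that sym_E unfolding sym_def by blast
  ultimately have "separation E (V - {b}) D"
    using assms(4) unfolding separation_def by blast
  then show False using no_cutvertex assms(2) by blast
qed

end

text \<open>\<open>partner\<close> expresses dependence: either \<open>{a, b}\<close> splits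
  \<open>{c, d}\<close> or the other way round. Demanding \<open>a \<in> F\<close> in the second
  case only fixes an orientation, as complements are separations too.\<close>

locale no_single_cutset = biconnected_relation +
  assumes partner: "\<lbrakk>a \<in> V; b \<in> V; a \<noteq> b; separation E (V - {a, b}) D\<rbrakk> \<Longrightarrow>
    \<exists>c d F. c \<in> V \<and> d \<in> V \<and> c \<noteq> d \<and> separation E (V - {c, d}) F \<and>
      ((\<exists>D'. separation E (V - {a, b}) D' \<and> c \<in> D' \<and> d \<in> V - {a, b} - D') \<or>
       a \<in> F \<and> b \<in> V - {c, d} - F)"
begin

text \<open>Turns one-sided dependence into mutual splitting, and makes the partner cross the given
  \<open>D\<close> rather than some other separation left by \<open>{a, b}\<close>.\<close>

lemma crossing_partner:
  assumes "a \<in> V" "b \<in> V" "a \<noteq> b" "separation E (V - {a, b}) D"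
  obtains c d F where "c \<in> D" "d \<in> V - {a, b} - D"
    "separation E (V - {c, d}) F" "a \<in> F" "b \<in> V - {c, d} - F"
proof -
  obtain c d F where cd: "c \<in> V" "d \<in> V" "c \<noteq> d" and F: "separation E (V - {c, d}) F"
    and split: "(\<exists>D'. separation E (V - {a, b}) D' \<and> c \<in> D' \<and> d \<in> V - {a, b} - D') \<or>
       a \<in> F \<and> b \<in> V - {c, d} - F"
    using partner[OF assms] by blast
  have "\<exists>F. separation E (V - {c, d}) F \<and> a \<in> F \<and> b \<in> V - {c, d} - F"
  proof (rule disjE[OF split])
    assume "\<exists>D'. separation E (V - {a, b}) D' \<and> c \<in> D' \<and> d \<in> V - {a, b} - D'"
    then obtain D' where D': "separation E (V - {a, b}) D'" "c \<in> D'" "d \<in> V - {a, b} - D'"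
      by blast
    have "a \<in> F \<longleftrightarrow> b \<notin> F" using crossing[OF assms(1,2) D' F] .
    moreover have "a \<in> V - {c, d}" "b \<in> V - {c, d}"
      using D' assms unfolding separation_def by auto
    ultimately show ?thesis
      using F separation_complement[OF sym_E F] by (cases "a \<in> F") blast+
  qed (use F in blast)
  then obtain F where F: "separation E (V - {c, d}) F" "a \<in> F" "b \<in> V - {c, d} - F" by blast
  \<comment> \<open>The pairs exchange roles: \<open>{a, b}\<close> is now known to be split by
    \<open>{c, d}\<close>, so every side left by \<open>{a, b}\<close> contains exactly one of
    \<open>c\<close>, \<open>d\<close>.\<close>
  have sep: "c \<in> D' \<longleftrightarrow> d \<notin> D'" if "separation E (V - {a, b}) D'" for D'
    using crossing[OF cd(1,2) F that] .
  have notin: "c \<notin> {a, b}" "d \<notin> {a, b}" using F unfolding separation_def by auto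
  show thesis
  proof (cases "c \<in> D")
    case True
    then show ?thesis using that[of c d F] F cd notin sep assms(4) by blast
  next
    case False
    have "d \<in> D" using False sep[OF assms(4)] by blast
    then show ?thesis
      using that[of d c F] F cd notin sep assms(4) False by (simp add: insert_commute)
  qed
qed

text \<open>The crossing pair puts \<open>a\<close> and \<open>b\<close> on opposite sides of a
  separation.\<close>

lemma separating_pair_not_adjacent:
  assumes "a \<in> V" "b \<in> V" "a \<noteq> b" "separation E (V - {a, b}) D"
  shows "(a, b) \<notin> E"
  using crossing_partner[OF assms] unfolding separation_def by metis

text \<open>The induction varies \<open>a\<close> and \<open>b\<close> because the smaller sides
  belong to the pairs \<open>{a, c}\<close> and \<open>{b, c}\<close>. As \<open>C\<close> is any
  separation, connectedness of each side comes out as well.\<close>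

lemma side_is_path:
  assumes "a \<in> V" "b \<in> V" "a \<noteq> b" "separation E (V - {a, b}) C"
  shows "\<exists>xs. set xs = C \<and> induced_path E (a # xs @ [b])"
  using assms
proof (induction "card C" arbitrary: a b C rule: less_induct)
  case less
  have C: "C \<subseteq> V - {a, b}" "\<And>u v. u \<in> C \<Longrightarrow> v \<in> V - {a, b} - C \<Longrightarrow> (u, v) \<notin> E"
    using less.prems(4) unfolding separation_def by auto
  have fin: "finite C" using C(1) finite_V finite_subset by blast
  obtain c d F where cd: "c \<in> C" "d \<in> V - {a, b} - C"
    and sepF: "separation E (V - {c, d}) F" and ab: "a \<in> F" "b \<in> V - {c, d} - F"
    using crossing_partner[OF less.prems] by blast
  have F: "F \<subseteq> V - {c, d}" "\<And>u v. u \<in> F \<Longrightarrow> v \<in> V - {c, d} - F \<Longrightarrow> (u, v) \<notin> E"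
    using sepF unfolding separation_def by auto
  have symE: "(u, v) \<in> E \<longleftrightarrow> (v, u) \<in> E" for u v using sym_E unfolding sym_def by blast
  \<comment> \<open>Covers both halves of the path at once: \<open>x = a\<close> with
    \<open>H = F\<close>, and \<open>x = b\<close> with the complement of \<open>F\<close>.\<close>
  have part: "\<exists>xs. set xs = C \<inter> H \<and> induced_path E (x # xs @ [c])"
    if x: "x = a \<and> y = b \<or> x = b \<and> y = a" and H: "H \<subseteq> V - {c, d}" "x \<in> H" "y \<in> V - {c, d} - H"
      and HE: "\<And>u v. u \<in> H \<Longrightarrow> v \<in> V - {c, d} - H \<Longrightarrow> (u, v) \<notin> E" for x y H
  proof -
    have xV: "x \<in> V" "y \<in> V" "x \<noteq> y" "c \<in> V" "x \<noteq> c" "y \<noteq> c" "x \<notin> C" "y \<notin> C"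
      and Cxy: "separation E (V - {x, y}) C"
      and sets: "{a, b} = {x, y}"
      using x less.prems C(1) cd by (auto simp: insert_commute)
    show ?thesis
    proof (cases "C \<inter> H = {}")
      case True
      obtain u where u: "u \<in> C" "(x, u) \<in> E"
        using attached[OF xV(1-3) Cxy] by blast
      \<comment> \<open>Edges from \<open>x\<close> leave \<open>H\<close> only to \<open>c\<close>
        or \<open>d\<close>; here \<open>u\<close> is outside \<open>H\<close>, and \<open>d\<close>
        is outside \<open>C\<close>.\<close>
      have "u = c" using u HE[OF H(2), of u] True C(1) cd(2) by blast
      then have "(x, c) \<in> E" "(c, x) \<in> E" using u symE by blast+
      then have "induced_path E (x # [] @ [c])"
        using xV irrefl_E unfolding induced_path_def by auto
      then show ?thesis using True by (intro exI[of _ "[]"]) simp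
    next
      case False
      have "card (C \<inter> H) < card C"
        using H(1) cd(1) fin by (intro psubset_card_mono) auto
      \<comment> \<open>A neighbour of \<open>C \<inter> H\<close> other than \<open>x\<close> and
        \<open>c\<close> would have to cross \<open>C\<close> (if it lies in \<open>H\<close> or is
        \<open>d\<close>) or cross \<open>H\<close>.\<close>
      moreover have "(u, v) \<notin> E" if u: "u \<in> C \<inter> H" and v: "v \<in> V - {x, c} - C \<inter> H" for u v
      proof (cases "v \<in> H")
        case True
        then have "v \<in> V - {a, b} - C" using v H sets by auto
        then show ?thesis using C(2) u by blast
      next
        case False
        show ?thesis
        proof (cases "v = d")
          case True
          then show ?thesis using C(2) u cd by blast
        next
          case False
          then show ?thesis using HE[of u v] u v \<open>v \<notin> H\<close> by blast
        qed
      qed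
      moreover have "C \<inter> H \<subseteq> V - {x, c}" "y \<in> V - {x, c} - C \<inter> H"
        using C(1) H xV sets by auto
      ultimately have "separation E (V - {x, c}) (C \<inter> H)"
        using False unfolding separation_def by blast
      then show ?thesis
        using less.hyps[of "C \<inter> H" x c] \<open>card (C \<inter> H) < card C\<close> xV by blast
    qed
  qed
  let ?H = "V - {c, d} - F"
  obtain xs where xs: "set xs = C \<inter> F" "induced_path E (a # xs @ [c])"
    using part[of a b F] F ab by blast
  have FH: "(u, v) \<notin> E" if "u \<in> ?H" "v \<in> V - {c, d} - ?H" for u v
    using F that symE by blast
  obtain zs where zs: "set zs = C \<inter> ?H" "induced_path E (b # zs @ [c])"
    using part[of b a ?H] FH F(1) ab by blast
  define ys where "ys = rev zs"
  have ys: "set ys = C \<inter> ?H" "induced_path E (c # ys @ [b])"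
    using zs induced_path_rev[OF zs(2)] by (simp_all add: ys_def)
  have in_F: "set (a # xs) \<subseteq> F" and in_H: "set (ys @ [b]) \<subseteq> ?H"
    using xs(1) ys(1) ab by auto
  have "induced_path E ((a # xs) @ c # (ys @ [b]))"
  proof (rule induced_path_append[OF sym_E])
    show "E \<inter> set (a # xs) \<times> set (ys @ [b]) = {}"
      using in_F in_H F(2) by blast
    show "set (a # xs) \<inter> set (ys @ [b]) = {}"
      using in_F in_H F(2) by blast
  qed (use xs(2) ys(2) in simp_all)
  moreover have "set (xs @ c # ys) = C"
    using xs(1) ys(1) C(1) cd F by auto
  ultimately show ?case by (intro exI[of _ "xs @ c # ys"]) simp
qed

text \<open>Both sides of the cutset are interiors of induced paths between \<open>a\<close> and
  \<open>b\<close>. No edge joins the sides, so each edge lies on one of the paths.\<close>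

lemma spanned_by_cycle:
  assumes "a \<in> V" "b \<in> V" "a \<noteq> b" "separation E (V - {a, b}) D" "E \<subseteq> V \<times> V"
  obtains vs where "distinct vs" "set vs = V" "3 \<le> length vs"
    "E = steps (vs @ [hd vs]) \<union> (steps (vs @ [hd vs]))\<inverse>"
proof -
  let ?D = "V - {a, b} - D"
  have D: "D \<subseteq> V - {a, b}" "D \<noteq> {}" "\<And>u v. u \<in> D \<Longrightarrow> v \<in> ?D \<Longrightarrow> (u, v) \<notin> E"
    using assms(4) unfolding separation_def by auto
  obtain xs where xs: "set xs = D" "induced_path E (a # xs @ [b])"
    using side_is_path[OF assms(1-4)] by blast
  have "separation E (V - {b, a}) ?D"
    using separation_complement[OF sym_E assms(4)] by (simp add: insert_commute)
  then obtain ys where ys: "set ys = ?D" "induced_path E (b # ys @ [a])"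
    using side_is_path[of b a ?D] assms(1-3) by blast
  let ?vs = "a # xs @ b # ys"
  have st: "steps (?vs @ [a]) = steps (a # xs @ [b]) \<union> steps (b # ys @ [a])"
    using steps_append[of "a # xs" b "ys @ [a]"] by simp
  have sets: "set (a # xs @ [b]) = insert a (insert b D)" "set (b # ys @ [a]) = insert a (insert b ?D)"
    using xs(1) ys(1) by auto
  have "E = (E \<inter> set (a # xs @ [b]) \<times> set (a # xs @ [b])) \<union>
      (E \<inter> set (b # ys @ [a]) \<times> set (b # ys @ [a]))" (is "E = ?E")
  proof (intro equalityI subrelI)
    fix u v assume uv: "(u, v) \<in> E"
    then have "(v, u) \<in> E" "u \<in> V" "v \<in> V" using sym_E assms(5) unfolding sym_def by auto
    then have "u \<in> insert a (insert b D) \<and> v \<in> insert a (insert b D) \<or>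
        u \<in> insert a (insert b ?D) \<and> v \<in> insert a (insert b ?D)"
      using uv D(3)[of u v] D(3)[of v u] by blast
    then show "(u, v) \<in> ?E"
      using uv unfolding sets by blast
  qed blast
  then have "E = steps (?vs @ [hd ?vs]) \<union> (steps (?vs @ [hd ?vs]))\<inverse>"
    using xs(2) ys(2) st unfolding induced_path_def by auto
  moreover have "distinct ?vs" "set ?vs = V"
    using xs ys D(1) assms(1,2) unfolding induced_path_def by auto
  moreover have "3 \<le> length ?vs"
    using xs(1) D(2) by (cases xs) auto
  ultimately show thesis using that by blast
qed

end

section \<open>Symmetric digraphs\<close>

context wf_digraph
begin

text \<open>An arc is chosen over each step; the last conjunct records the vertex pairs covered, so
  that arc sets can be compared.\<close>

lemma steps_awalk:
  assumes "steps vs \<subseteq> arcs_ends G" "vs \<noteq> []" "hd vs \<in> verts G"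
  shows "\<exists>p. awalk (hd vs) p (last vs) \<and> awalk_verts (hd vs) p = vs \<and>
    map (arc_to_ends G) p = zip vs (tl vs)"
  using assms
proof (induction vs rule: induct_list012)
  case (2 u)
  then show ?case by (intro exI[of _ "[]"]) (simp add: awalk_Nil_iff)
next
  case (3 u v vs)
  obtain e where e: "e \<in> arcs G" "tail G e = u" "head G e = v"
    using 3(3) by (auto simp: arcs_ends_conv)
  then have ee: "arc_to_ends G e = (u, v)" by (simp add: arc_to_ends_def)
  obtain p where "awalk v p (last (v # vs))" "awalk_verts v p = v # vs"
    "map (arc_to_ends G) p = zip (v # vs) (tl (v # vs))"
    using 3 e by fastforce
  then show ?case
    using e ee by (intro exI[of _ "e # p"]) (auto simp: awalk_Cons_iff)
qed simp

lemma is_simple_cycleI: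
  assumes "distinct vs" "set vs = verts G" "3 \<le> length vs"
    and E: "arcs_ends G = steps (vs @ [hd vs]) \<union> (steps (vs @ [hd vs]))\<inverse>"
  shows "is_simple_cycle G"
proof -
  let ?ws = "vs @ [hd vs]"
  have ne: "vs \<noteq> []" using assms(3) by auto
  then have ends: "hd ?ws = hd vs" "last ?ws = hd vs" "hd ?ws \<in> verts G"
    using assms(2) hd_in_set[OF ne] by simp_all
  obtain p where p: "awalk (hd vs) p (hd vs)" "awalk_verts (hd vs) p = ?ws"
    "map (arc_to_ends G) p = zip ?ws (tl ?ws)"
    using steps_awalk[of ?ws] E ends by (metis Un_upper1 append_is_Nil_conv list.distinct(1))
  have len: "length p = length vs"
    using arg_cong[OF p(2), of length] by (simp add: length_awalk_verts)
  have "cycle p"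
    using p(1,2) assms(1) ne len unfolding cycle_def by (cases vs) auto
  moreover have "arc_to_ends G ` set p = steps ?ws"
    using arg_cong[OF p(3), of set] by (simp add: steps_def)
  \<comment> \<open>The closing vertex is only the head of the last arc, so the tails list each
    vertex once.\<close>
  moreover have "map (tail G) p = vs"
    using p(2) ne len by (auto simp: awalk_verts_conv split: if_splits)
  then have "tail G ` set p = verts G"
    using assms(2) by (metis list.set_map)
  ultimately show ?thesis
    using E len assms(3) unfolding is_simple_cycle_def by (intro exI[of _ p]) simp
qed

end

section \<open>Connectedness, components and cutsets in terms of separations\<close>

context sym_digraph
begin

text \<open>Connectedness is defined through \<open>mk_symmetric\<close>, which leaves reachability
  in a symmetric digraph unchanged.\<close>

lemma connected_iff_strongly_connected: "connected G \<longleftrightarrow> strongly_connected G"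
  using symmetric_connected_imp_strongly_connected[OF sym_arcs] reachable_mk_symmetric_eq[OF sym_arcs]
  unfolding connected_def strongly_connected_def by auto

lemma separation_reachable:
  assumes "separation (arcs_ends G) (verts G) D" "u \<in> D" "u \<rightarrow>\<^sup>* v"
  shows "v \<in> D"
  using assms(3,2)
proof (induction rule: reachable_induct)
  case (step x y)
  then show ?case
    using assms(1) unfolding separation_def by (meson DiffI adj_in_verts(2))
qed simp

lemma separation_reachable_set:
  assumes "u \<in> verts G" "v \<in> verts G" "\<not> u \<rightarrow>\<^sup>* v"
  shows "separation (arcs_ends G) (verts G) {w. u \<rightarrow>\<^sup>* w}"
  using assms unfolding separation_def
  by (auto dest: reachable_in_verts intro: reachable_adj_trans)

text \<open>A separation is closed under reachability; conversely, if \<open>v\<close> is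
  unreachable from \<open>u\<close>, the vertices reachable from \<open>u\<close> form one.\<close>

lemma connected_iff_no_separation:
  "connected G \<longleftrightarrow> verts G \<noteq> {} \<and> (\<nexists>D. separation (arcs_ends G) (verts G) D)"
proof -
  have False if D: "separation (arcs_ends G) (verts G) D" and conn: "strongly_connected G" for D
  proof -
    obtain u v where "u \<in> D" "v \<in> verts G - D" "u \<in> verts G"
      using D unfolding separation_def by blast
    then show False
      using separation_reachable[OF D] conn unfolding strongly_connected_def by blast
  qed
  then show ?thesis
    using separation_reachable_set unfolding connected_iff_strongly_connected strongly_connected_def
    by blast
qed

text \<open>A connected \<open>K\<close> above the induced subgraph contains \<open>u\<close>, so
  all its vertices are reachable from \<open>u\<close> in \<open>G\<close>. \<open>K\<close> is not
  known to be symmetric, hence the detour through \<open>mk_symmetric\<close>.\<close>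

lemma reachable_set_component:
  assumes "u \<in> verts G"
  shows "{w. u \<rightarrow>\<^sup>* w} \<in> connected_components G"
proof -
  let ?H = "G \<restriction> {w. u \<rightarrow>\<^sup>* w}"
  have sub: "induced_subgraph ?H G"
    by (rule induced_induce) (auto dest: reachable_in_verts)
  interpret H: sym_digraph ?H by (rule induced_graph_imp_graph[OF sub])
  have "strongly_connected ?H"
    using induce_reachable_is_in_sccs[OF assms] by blast
  then have conn: "connected ?H" using H.connected_iff_strongly_connected by blast
  have "K = ?H" if K: "subgraph ?H K" "subgraph K G" "connected K" for K
  proof -
    have "w \<in> verts ?H" if "w \<in> verts K" for w
    proof -
      have "u \<in> verts K" using K(1) assms by (auto simp: subgraph_def)
      then have "u \<rightarrow>\<^sup>*\<^bsub>mk_symmetric K\<^esub> w"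
        using K(3) that unfolding connected_def strongly_connected_def by simp
      then have "u \<rightarrow>\<^sup>*\<^bsub>mk_symmetric G\<^esub> w"
        using pre_digraph.reachable_mono subgraph_mk_symmetric[OF K(2)] by fastforce
      then show ?thesis by (simp add: reachable_mk_symmetric_eq[OF sym_arcs])
    qed
    then have V: "verts K = verts ?H" using K(1) by (auto simp: subgraph_def)
    then have "arcs K = arcs ?H"
      using K(1,2) wf_digraph.wellformed[of K]
      by (auto simp: subgraph_def compatible_def)
    then show ?thesis
      using V K(2) by (auto simp: subgraph_def compatible_def)
  qed
  then have "max_subgraph connected ?H"
    using conn induced_imp_subgraph[OF sub] unfolding max_subgraph_def by blast
  then show ?thesis
    unfolding connected_components_def by (metis (mono_tags) image_eqI induce_subgraph_verts mem_Collect_eq)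
qed

lemma arcs_ends_induce: "arcs_ends (G \<restriction> X) = arcs_ends G \<inter> X \<times> X"
  by (auto simp: arcs_ends_conv)

lemma separation_induce:
  "separation (arcs_ends (G \<restriction> X)) X D \<longleftrightarrow> separation (arcs_ends G) X D"
  unfolding separation_def arcs_ends_induce by blast

lemma sym_digraph_delete_verts: "sym_digraph (delete_verts G R)"
  unfolding delete_verts_def by (rule induced_graph_imp_graph) blast

lemma cutset_iff:
  "cutset G R \<longleftrightarrow> R \<subset> verts G \<and> (\<exists>D. separation (arcs_ends G) (verts G - R) D)"
  using sym_digraph.connected_iff_no_separation[OF sym_digraph_delete_verts, of R]
  unfolding cutset_def by (auto simp: delete_verts_def separation_induce)

lemma splits_separation:
  assumes "splits G R X" "R \<subset> verts G" "X \<subseteq> verts G"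
  obtains D x y where "separation (arcs_ends G) (verts G - R) D" "x \<in> X \<inter> D" "y \<in> X - R - D"
proof -
  let ?H = "delete_verts G R"
  interpret H: sym_digraph ?H by (rule sym_digraph_delete_verts)
  have V: "verts ?H = verts G - R" by (simp add: delete_verts_def)
  have no: "\<not> X - R \<subseteq> {w. u \<rightarrow>\<^sup>*\<^bsub>?H\<^esub> w}" if "u \<in> verts G - R" for u
    using H.reachable_set_component[of u] assms(1) that V unfolding splits_def by blast
  \<comment> \<open>An empty \<open>X - R\<close> would lie in every component, and one exists
    because \<open>R\<close> is a proper subset.\<close>
  then obtain x where x: "x \<in> X - R" using assms(2) by blast
  then obtain y where y: "y \<in> X - R" "\<not> x \<rightarrow>\<^sup>*\<^bsub>?H\<^esub> y" using no[of x] assms(3) by blast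
  have "separation (arcs_ends ?H) (verts ?H) {w. x \<rightarrow>\<^sup>*\<^bsub>?H\<^esub> w}"
    using H.separation_reachable_set[of x y] x y assms(3) V by blast
  then have "separation (arcs_ends G) (verts G - R) {w. x \<rightarrow>\<^sup>*\<^bsub>?H\<^esub> w}"
    unfolding V unfolding delete_verts_def separation_induce .
  moreover have "x \<rightarrow>\<^sup>*\<^bsub>?H\<^esub> x" using x assms(3) V by auto
  ultimately show thesis using that x y by blast
qed

end

theorem theorem2:
  fixes G :: "('a, 'b) pre_digraph"
  assumes "graph G"
    and "biconnected G"
    and "\<not> (\<exists>S. single_cutset G S)"
  shows "triconnected G \<or> is_simple_cycle G"
proof (rule disjCI)
  assume not_cycle: "\<not> is_simple_cycle G"
  interpret graph G by fact
  let ?V = "verts G" and ?E = "arcs_ends G"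
  have card: "2 < card ?V" and small: "\<And>R. cutset G R \<Longrightarrow> 2 \<le> card R"
    using assms(2) unfolding k_connected_def by (auto simp: not_less)
  have symE: "sym ?E" using sym_arcs unfolding symmetric_def .
  interpret biconnected_relation ?V ?E
  proof
    show "\<not> separation ?E ?V D" for D
      using small[of "{}"] card unfolding cutset_iff by fastforce
    show "\<not> separation ?E (?V - {x}) D" if "x \<in> ?V" for x D
    proof
      assume "separation ?E (?V - {x}) D"
      then have "cutset G {x}" using that unfolding cutset_iff separation_def by blast
      then show False using small[of "{x}"] by simp
    qed
  qed (use symE adj_not_same in auto)
  have cutset2: "{a, b} \<in> cutsets2 G"
    if "a \<in> ?V" "b \<in> ?V" "a \<noteq> b" "separation ?E (?V - {a, b}) D" for a b D
    using that unfolding cutsets2_def cutset_iff separation_def by auto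
  have no_cutset2: "cutsets2 G = {}"
  proof (rule ccontr)
    interpret no_single_cutset ?V ?E
    proof
      fix a b D
      assume ab: "a \<in> ?V" "b \<in> ?V" "a \<noteq> b" and D: "separation ?E (?V - {a, b}) D"
      \<comment> \<open>\<open>T\<close> witnesses that the cutset \<open>{a, b}\<close> is not
        single.\<close>
      obtain T where T: "T \<in> cutsets2 G" and spl: "splits G {a, b} T \<or> splits G T {a, b}"
        using assms(3) cutset2[OF ab D] unfolding single_cutset_def independent_cutsets_def by blast
      obtain F where TV: "T \<subset> ?V" and "card T = 2" and F: "separation ?E (?V - T) F"
        using T unfolding cutsets2_def cutset_iff by blast
      then obtain c d where cd: "T = {c, d}" "c \<noteq> d" by (meson card_2_iff)
      have abV: "{a, b} \<subset> ?V" using cutset2[OF ab D] unfolding cutsets2_def cutset_iff by blast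
      show "\<exists>c d F. c \<in> ?V \<and> d \<in> ?V \<and> c \<noteq> d \<and> separation ?E (?V - {c, d}) F \<and>
          ((\<exists>D'. separation ?E (?V - {a, b}) D' \<and> c \<in> D' \<and> d \<in> ?V - {a, b} - D') \<or>
           a \<in> F \<and> b \<in> ?V - {c, d} - F)"
        using spl
      proof
        assume "splits G {a, b} T"
        then obtain D' x y where D': "separation ?E (?V - {a, b}) D'" "x \<in> T \<inter> D'" "y \<in> T - {a, b} - D'"
          using splits_separation[OF _ abV, of T] TV by blast
        \<comment> \<open>The separated vertices \<open>x\<close>, \<open>y\<close> exhaust
          \<open>T\<close>, so they serve as the required \<open>c\<close>,
          \<open>d\<close>.\<close>
        then have xy: "T = {x, y}" "x \<noteq> y" using cd by auto
        then have "x \<in> ?V" "y \<in> ?V" "separation ?E (?V - {x, y}) F" using TV F by auto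
        moreover have "x \<in> D'" "y \<in> ?V - {a, b} - D'" using D' \<open>y \<in> ?V\<close> by auto
        ultimately show ?thesis using xy(2) D'(1) by blast
      next
        assume "splits G T {a, b}"
        then obtain F' x y where F': "separation ?E (?V - T) F'" "x \<in> {a, b} \<inter> F'" "y \<in> {a, b} - T - F'"
          using splits_separation[OF _ TV, of "{a, b}"] abV by blast
        have "a \<notin> T" "b \<notin> T" using F' ab(3) unfolding separation_def by auto
        then have "\<exists>F. separation ?E (?V - T) F \<and> a \<in> F \<and> b \<in> ?V - T - F"
          using F' separation_complement[OF symE F'(1)] ab by (cases "x = a") blast+
        then show ?thesis using cd TV by blast
      qed
    qed
    assume "cutsets2 G \<noteq> {}"
    then obtain S D where S: "S \<subset> ?V" "card S = 2" "separation ?E (?V - S) D"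
      unfolding cutsets2_def cutset_iff by blast
    then obtain a b where ab: "S = {a, b}" "a \<noteq> b" by (meson card_2_iff)
    have "?E \<subseteq> ?V \<times> ?V" using adj_in_verts by auto
    then obtain vs where "distinct vs" "set vs = ?V" "3 \<le> length vs"
        "?E = steps (vs @ [hd vs]) \<union> (steps (vs @ [hd vs]))\<inverse>"
      using spanned_by_cycle[of a b D] S ab by blast
    then show False using is_simple_cycleI not_cycle by blast
  qed
  \<comment> \<open>Triconnectedness demands more than three vertices. On three, deleting any one
    must leave an adjacent pair, so the graph is a triangle and hence a cycle.\<close>
  have "card ?V \<noteq> 3"
  proof
    assume "card ?V = 3"
    then obtain x y z where V: "?V = {x, y, z}" and ne: "x \<noteq> y" "y \<noteq> z" "x \<noteq> z"
      by (metis card_3_iff)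
    have adj: "(u, v) \<in> ?E" if "?V = {u, v, w}" "u \<noteq> v" "v \<noteq> w" "u \<noteq> w" for u v w
    proof (rule ccontr)
      assume "(u, v) \<notin> ?E"
      moreover have "?V - {w} = {u, v}" unfolding that(1) using that(3,4) by blast
      ultimately have "separation ?E (?V - {w}) {u}"
        using that(2) unfolding separation_def by auto
      then show False using no_cutvertex[of w] that(1) by blast
    qed
    have "(x, y) \<in> ?E" "(y, z) \<in> ?E" "(z, x) \<in> ?E"
      using adj[of x y z] adj[of y z x] adj[of z x y] V ne by auto
    moreover have "?E \<subseteq> ?V \<times> ?V" using adj_in_verts by auto
    moreover have "(y, x) \<in> ?E" "(z, y) \<in> ?E" "(x, z) \<in> ?E"
      using calculation symE unfolding sym_def by blast+
    ultimately have "?E = {(x, y), (y, z), (z, x), (y, x), (z, y), (x, z)}"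
      using irrefl_E unfolding V by blast
    then have "?E = steps ([x, y, z] @ [hd [x, y, z]]) \<union> (steps ([x, y, z] @ [hd [x, y, z]]))\<inverse>"
      by auto
    then have "is_simple_cycle G"
      using V ne by (intro is_simple_cycleI[of "[x, y, z]"]) auto
    then show False using not_cycle by blast
  qed
  moreover have "3 \<le> card R" if "cutset G R" for R
    using small[OF that] no_cutset2 that unfolding cutsets2_def by (cases "card R = 2") auto
  ultimately show "triconnected G"
    using card unfolding k_connected_def by (auto simp: not_less)
qed

end
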